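(* Let $\mathcal{F}=\{F_i : i\in\mathbb{N}\}$ be a countable family of contractive similarities of $\mathbb{R}$, i.e. for each $i$ there is $r_i<1$ such that $|F_i(x)-F_i(y)|=r_i|x-y|$ for all $x,y\in\mathbb{R}$. Suppose that $r:=\sup_i r_i=1$. If there exists a bounded set $A$ that is invariant for $\mathcal{F}$, then there exists $\alpha>0$ such that $\overline{A_\alpha}$ is invariant for $\mathcal{F}$. (Hence, if a bounded invariant set exists, it is not unique.)
   Context: A non-empty set $E\subset\mathbb{R}$ is an invariant set for $\mathcal{F}$ if $E=\overline{\bigcup_{i=1}^\infty F_i(E)}$. For $A\subset\mathbb{R}$ and $\alpha>0$, $A_\alpha=\{y\in\mathbb{R} : d(y,A)<\alpha\}$ is the $\alpha$-enlargement of $A$, where $d(y,A)=\inf_{a\in A}|y-a|$. *)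

theory Defs
  imports "HOL-Analysis.Analysis"
begin

definition invariant_set :: "(nat \<Rightarrow> real \<Rightarrow> real) \<Rightarrow> real set \<Rightarrow> bool" where
  "invariant_set F E \<longleftrightarrow> E \<noteq> {} \<and> E = closure (\<Union>i. F i ` E)"

(* Since infdist y {} = 0, the enlargement of the empty set comes out as UNIV rather
   than {}; invariant sets are non-empty, so this case does not arise for them. *)
definition enlargement :: "real set \<Rightarrow> real \<Rightarrow> real set" where
  "enlargement A \<alpha> = {y. infdist y A < \<alpha>}"

end

theory Submission
  imports Defs
begin

text \<open>
  Let \<open>m\<close> and \<open>M\<close> be the least and the greatest element of the compact set \<open>A\<close>.
  Since \<open>A\<close> is invariant, a map \<open>F i\<close> with \<open>r i\<close> close to \<open>1\<close> sends \<open>m\<close> and \<open>M\<close> to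
  points of \<open>[m, M]\<close> whose distance is almost \<open>M - m\<close>. So \<open>F i\<close> is close either to the
  identity or to the reflection \<open>x \<mapsto> m + M - x\<close>, according to its orientation. One of the two
  orientations occurs with ratios arbitrarily close to \<open>1\<close>, hence one of these two isometries,
  call it \<open>G\<close>, is a pointwise limit of maps of the family (\<open>ratios_near_1_imp_isometric_limit\<close>).

  As \<open>A\<close> is closed and mapped into itself by all \<open>F i\<close>, it is mapped into itself by \<open>G\<close>.
  Maps that do not increase distances and preserve \<open>A\<close> also preserve every enlargement of \<open>A\<close>,
  so the closed enlargement \<open>E\<close> is preserved by each \<open>F i\<close> and by \<open>G\<close>. Being an
  involution, \<open>G\<close> maps \<open>E\<close> onto \<open>E\<close>, so every point of \<open>E\<close> is some \<open>G x\<close> with \<open>x \<in> E\<close>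
  and therefore a limit of points \<open>F i x\<close>. This is the invariance of \<open>E\<close>, and the argument
  works for every \<open>\<alpha> > 0\<close>.
\<close>

text \<open>
  Squaring the distances of \<open>f x\<close> to \<open>f 0\<close> and to \<open>f 1\<close> gives two quadratic equations for
  \<open>f x - f 0\<close>, whose difference is linear.
\<close>
lemma real_similarity_affine:
  fixes f :: "real \<Rightarrow> real"
  assumes sim: "\<And>x y. \<bar>f x - f y\<bar> = c * \<bar>x - y\<bar>"
  obtains s where "\<bar>s\<bar> = c" "\<And>x. f x = f 0 + s * x"
proof
  show c: "\<bar>f 1 - f 0\<bar> = c"
    using sim[of 1 0] by simp
  show "f x = f 0 + (f 1 - f 0) * x" for x
  proof -
    let ?s = "f 1 - f 0"
    have "\<bar>f x - f 0\<bar>^2 = \<bar>?s * x\<bar>^2" "\<bar>f x - f 1\<bar>^2 = \<bar>?s * (x - 1)\<bar>^2"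
      using sim[of x 0] sim[of x 1] c by (simp_all add: abs_mult)
    then have sq: "(f x - f 0)^2 = (?s * x)^2" "(f x - f 1)^2 = (?s * (x - 1))^2"
      by simp_all
    then have "?s * (f x - f 0 - ?s * x) = 0"
      by algebra
    then show ?thesis
      using sq(1) by auto
  qed
qed

text \<open>
  The left endpoint moves to the right by at most the length \<open>(1 - s) * (M - m)\<close> by which
  the image of \<open>[m, M]\<close> is shorter than \<open>[m, M]\<close>; away from \<open>m\<close> the contraction contributes
  the other term.
\<close>
lemma increasing_affine_near_identity:
  fixes m M :: real
  assumes f: "\<And>x. f x = b + s * x" and s: "s \<le> 1"
    and "m \<le> f m" "f M \<le> M"
  shows "\<bar>f x - x\<bar> \<le> (1 - s) * (\<bar>x - m\<bar> + (M - m))"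
proof -
  have "f m - m \<le> (1 - s) * (M - m)"
    using assms(4) by (simp add: f algebra_simps)
  then have "\<bar>f m - m\<bar> \<le> (1 - s) * (M - m)"
    using assms(3) by simp
  moreover have "\<bar>(1 - s) * (x - m)\<bar> = (1 - s) * \<bar>x - m\<bar>"
    using s by (simp add: abs_mult)
  moreover have "f x - x = (f m - m) - (1 - s) * (x - m)"
    by (simp add: f algebra_simps)
  ultimately show ?thesis
    by (simp add: distrib_left)
qed

text \<open>
  The isometry is the identity if orientation-preserving maps of the family have ratios
  arbitrarily close to \<open>1\<close>, and otherwise the reflection that swaps \<open>m\<close> and \<open>M\<close>: composing
  an orientation-reversing map with this reflection reduces the second case to the first.
\<close>
lemma ratios_near_1_imp_isometric_limit:
  fixes F :: "'i \<Rightarrow> real \<Rightarrow> real" and r :: "'i \<Rightarrow> real" and m M :: real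
  assumes lt: "\<And>i. r i < 1"
    and sim: "\<And>i x y. \<bar>F i x - F i y\<bar> = r i * \<bar>x - y\<bar>"
    and near: "\<And>e. e > 0 \<Longrightarrow> \<exists>i. 1 - e < r i"
    and m: "\<And>i. F i m \<in> {m..M}" and M: "\<And>i. F i M \<in> {m..M}"
  obtains G :: "real \<Rightarrow> real" where "\<And>x. G (G x) = x" "\<And>x y. dist (G x) (G y) = dist x y"
    "\<And>x e. e > 0 \<Longrightarrow> \<exists>i. dist (F i x) (G x) < e"
proof -
  have "\<exists>s. \<bar>s\<bar> = r i \<and> (\<forall>x. F i x = F i 0 + s * x)" for i
    using real_similarity_affine[of "F i" "r i"] sim by metis
  then obtain s where s: "\<And>i. \<bar>s i\<bar> = r i" and aff: "\<And>i x. F i x = F i 0 + s i * x"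
    by metis
  have "m \<le> M"
    using m[of undefined] by simp
  \<comment> \<open>The summand \<open>1\<close> keeps the divisor \<open>K x\<close> positive when \<open>x = m = M\<close>.\<close>
  define K where "K x = \<bar>x - m\<bar> + (M - m) + 1" for x
  have K: "K x > 0" for x
    using \<open>m \<le> M\<close> by (simp add: K_def)
  have small: "(1 - t) * (\<bar>x - m\<bar> + (M - m)) < e" if "1 - e / K x < t" "t < 1" for t x e
  proof -
    have "(1 - t) * (\<bar>x - m\<bar> + (M - m)) \<le> (1 - t) * K x"
      using that(2) by (intro mult_left_mono) (simp_all add: K_def)
    also have "\<dots> < e"
      using that(1) K[of x] by (simp add: field_simps)
    finally show ?thesis .
  qed
  have "(\<forall>e>0. \<exists>i. s i \<ge> 0 \<and> 1 - e < r i) \<or> (\<forall>e>0. \<exists>i. s i \<le> 0 \<and> 1 - e < r i)"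
  proof (rule ccontr)
    assume "\<not> ?thesis"
    then obtain e1 e2 where e: "e1 > 0" "e2 > 0"
      and no: "\<And>i. s i \<ge> 0 \<Longrightarrow> r i \<le> 1 - e1" "\<And>i. s i \<le> 0 \<Longrightarrow> r i \<le> 1 - e2"
      by (metis not_le)
    obtain i where "1 - min e1 e2 < r i"
      using near[of "min e1 e2"] e by auto
    then show False
      using no[of i] by linarith
  qed
  then consider (preserving) "\<And>e. e > 0 \<Longrightarrow> \<exists>i. s i \<ge> 0 \<and> 1 - e < r i"
    | (reversing) "\<And>e. e > 0 \<Longrightarrow> \<exists>i. s i \<le> 0 \<and> 1 - e < r i"
    by blast
  then show ?thesis
  proof cases
    case preserving
    have "\<exists>i. dist (F i x) x < e" if "e > 0" for x e
    proof -
      obtain i where i: "s i \<ge> 0" "1 - e / K x < r i"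
        using preserving[of "e / K x"] \<open>e > 0\<close> K by auto
      have si: "s i = r i"
        using s[of i] i(1) by simp
      have "\<bar>F i x - x\<bar> \<le> (1 - s i) * (\<bar>x - m\<bar> + (M - m))"
        by (rule increasing_affine_near_identity[OF aff])
          (use lt[of i] si m[of i] M[of i] in auto)
      also have "\<dots> < e"
        using small[of e x "s i"] i(2) lt[of i] si by simp
      finally show ?thesis
        by (auto simp: dist_real_def)
    qed
    then show ?thesis
      using that[of "\<lambda>x. x"] by simp
  next
    case reversing
    have "\<exists>i. dist (F i x) (m + M - x) < e" if "e > 0" for x e
    proof -
      obtain i where i: "s i \<le> 0" "1 - e / K x < r i"
        using reversing[of "e / K x"] \<open>e > 0\<close> K by auto
      have si: "- s i = r i"
        using s[of i] i(1) by simp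
      have "m + M - F i y = (m + M - F i 0) + (- s i) * y" for y
        by (subst aff) simp
      then have "\<bar>(m + M - F i x) - x\<bar> \<le> (1 - (- s i)) * (\<bar>x - m\<bar> + (M - m))"
        by (rule increasing_affine_near_identity)
          (use lt[of i] si m[of i] M[of i] in auto)
      also have "\<dots> < e"
        using small[of e x "- s i"] i(2) lt[of i] si by simp
      finally show ?thesis
        by (auto simp: dist_real_def abs_minus_commute algebra_simps)
    qed
    then show ?thesis
      using that[of "\<lambda>x. m + M - x"] by (simp add: dist_real_def abs_minus_commute)
  qed
qed

lemma enlargement_nearby:
  assumes "y \<in> enlargement A \<alpha>" "A \<noteq> {}"
  obtains a where "a \<in> A" "dist y a < \<alpha>"
proof -
  have "(INF a\<in>A. dist y a) < \<alpha>"
    using assms by (simp add: enlargement_def infdist_notempty)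
  then show ?thesis
    using that \<open>A \<noteq> {}\<close> by (auto simp: cINF_less_iff)
qed

lemma nonexpansive_image_enlargement:
  fixes f :: "real \<Rightarrow> real"
  assumes f: "\<And>x y. dist (f x) (f y) \<le> dist x y" and "f ` A \<subseteq> A" and "A \<noteq> {}"
  shows "f ` enlargement A \<alpha> \<subseteq> enlargement A \<alpha>"
proof
  fix z assume "z \<in> f ` enlargement A \<alpha>"
  then obtain y where y: "z = f y" "y \<in> enlargement A \<alpha>"
    by blast
  then obtain a where a: "a \<in> A" "dist y a < \<alpha>"
    using enlargement_nearby \<open>A \<noteq> {}\<close> by blast
  have "infdist z A \<le> dist z (f a)"
    using a \<open>f ` A \<subseteq> A\<close> by (intro infdist_le) auto
  also have "\<dots> < \<alpha>"
    using f[of y a] a y by simp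
  finally show "z \<in> enlargement A \<alpha>"
    by (simp add: enlargement_def)
qed

lemma nonexpansive_image_closure_enlargement:
  fixes f :: "real \<Rightarrow> real"
  assumes f: "\<And>x y. dist (f x) (f y) \<le> dist x y" and "f ` A \<subseteq> A" and "A \<noteq> {}"
  shows "f ` closure (enlargement A \<alpha>) \<subseteq> closure (enlargement A \<alpha>)"
proof -
  have "1-lipschitz_on UNIV f"
    using f by (intro lipschitz_onI) auto
  then have "continuous_on (closure (enlargement A \<alpha>)) f"
    by (meson continuous_on_subset lipschitz_on_continuous_on subset_UNIV)
  then show ?thesis
    using nonexpansive_image_enlargement[OF assms] closure_subset
    by (intro image_closure_subset) auto
qed

lemma enlargement_superset: "\<alpha> > 0 \<Longrightarrow> A \<subseteq> enlargement A \<alpha>"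
  by (auto simp: enlargement_def)

lemma bounded_enlargement:
  assumes "bounded A" "A \<noteq> {}"
  shows "bounded (enlargement A \<alpha>)"
proof -
  obtain c K where K: "\<And>a. a \<in> A \<Longrightarrow> dist c a \<le> K"
    using \<open>bounded A\<close> by (auto simp: bounded_def)
  have "dist c y \<le> K + \<alpha>" if "y \<in> enlargement A \<alpha>" for y
  proof -
    obtain a where "a \<in> A" "dist y a < \<alpha>"
      using enlargement_nearby \<open>y \<in> enlargement A \<alpha>\<close> \<open>A \<noteq> {}\<close> by blast
    then show ?thesis
      using K[of a] dist_triangle2[of c y a] by simp
  qed
  then show ?thesis
    by (auto simp: bounded_def)
qed

text \<open>The point \<open>Sup A + \<alpha> / 2\<close> lies in the enlargement but beyond \<open>A\<close>.\<close>
lemma closure_enlargement_neq: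
  assumes "bounded A" "A \<noteq> {}" "closed A" "\<alpha> > 0"
  shows "closure (enlargement A \<alpha>) \<noteq> A"
proof
  assume eq: "closure (enlargement A \<alpha>) = A"
  have bdd: "bdd_above A"
    using \<open>bounded A\<close> by (rule bounded_imp_bdd_above)
  have "Sup A \<in> A"
    using assms bdd by (intro closed_contains_Sup)
  then have "infdist (Sup A + \<alpha> / 2) A \<le> \<alpha> / 2"
    using infdist_le[of "Sup A" A "Sup A + \<alpha> / 2"] \<open>\<alpha> > 0\<close> by (simp add: dist_real_def)
  then have "Sup A + \<alpha> / 2 \<in> A"
    using eq closure_subset[of "enlargement A \<alpha>"] \<open>\<alpha> > 0\<close> by (auto simp: enlargement_def)
  then show False
    using cSup_upper[OF _ bdd, of "Sup A + \<alpha> / 2"] \<open>\<alpha> > 0\<close> by simp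
qed

text \<open>
  The involution supplies surjectivity: a point \<open>y\<close> of \<open>E\<close> is \<open>G (G y)\<close> with \<open>G y \<in> E\<close>,
  so it is a limit of points \<open>F i (G y)\<close>.
\<close>
lemma invariant_set_if_limit_involution:
  assumes "E \<noteq> {}" "closed E" and F: "\<And>i. F i ` E \<subseteq> E"
    and G: "G ` E \<subseteq> E" "\<And>x. G (G x) = x"
    and lim: "\<And>x e. e > 0 \<Longrightarrow> \<exists>i. dist (F i x) (G x) < e"
  shows "invariant_set F E"
proof -
  have "closure (\<Union>i. F i ` E) \<subseteq> E"
    using F \<open>closed E\<close> by (intro closure_minimal) auto
  moreover have "y \<in> closure (\<Union>i. F i ` E)" if "y \<in> E" for y
    unfolding closure_approachable
  proof (intro allI impI)
    fix e :: real assume "e > 0"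
    then obtain i where "dist (F i (G y)) y < e"
      using lim[of e "G y"] G(2) by auto
    then show "\<exists>z\<in>\<Union>i. F i ` E. dist z y < e"
      using G(1) \<open>y \<in> E\<close> by blast
  qed
  ultimately show ?thesis
    using \<open>E \<noteq> {}\<close> unfolding invariant_set_def by blast
qed

theorem theorem2p10:
  fixes F :: "nat \<Rightarrow> real \<Rightarrow> real" and r :: "nat \<Rightarrow> real" and A :: "real set"
  assumes "\<And>i. r i < 1"
    and "\<And>i x y. \<bar>F i x - F i y\<bar> = r i * \<bar>x - y\<bar>"
    and "(SUP i. r i) = 1"
    and "bounded A"
    and "invariant_set F A"
  shows "(\<exists>\<alpha>>0. invariant_set F (closure (enlargement A \<alpha>))) \<and>
         (\<exists>B. bounded B \<and> invariant_set F B \<and> B \<noteq> A)"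
proof -
  have "A \<noteq> {}" and A: "A = closure (\<Union>i. F i ` A)"
    using assms(5) by (auto simp: invariant_set_def)
  have "closed A"
    by (subst A) simp
  have "(\<Union>i. F i ` A) \<subseteq> A"
    by (subst (2) A) (rule closure_subset)
  then have FA: "F i ` A \<subseteq> A" for i
    by blast
  have bdd: "bdd_below A" "bdd_above A"
    using \<open>bounded A\<close> by (auto intro: bounded_imp_bdd_below bounded_imp_bdd_above)
  have "A \<subseteq> {Inf A..Sup A}"
    using bdd by (auto intro: cInf_lower cSup_upper)
  moreover have "Inf A \<in> A" "Sup A \<in> A"
    using bdd \<open>A \<noteq> {}\<close> \<open>closed A\<close> by (auto intro: closed_contains_Inf closed_contains_Sup)
  ultimately have ends: "F i (Inf A) \<in> {Inf A..Sup A}" "F i (Sup A) \<in> {Inf A..Sup A}" for i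
    using FA by blast+
  have near: "\<exists>i. 1 - e < r i" if "e > 0" for e
  proof -
    have "bdd_above (range r)"
      using assms(1) by (intro bdd_aboveI[of _ 1]) (auto intro: less_imp_le)
    then show ?thesis
      using less_cSUP_iff[of UNIV r "1 - e"] assms(3) that by simp
  qed
  obtain G where G: "\<And>x. G (G x) = x" "\<And>x y. dist (G x) (G y) = dist x y"
    and lim: "\<And>x e. e > 0 \<Longrightarrow> \<exists>i. dist (F i x) (G x) < e"
    using ratios_near_1_imp_isometric_limit[OF assms(1,2) near ends] by metis
  have GA: "G ` A \<subseteq> A"
  proof
    fix z assume "z \<in> G ` A"
    then obtain x where x: "x \<in> A" "z = G x"
      by blast
    have "\<exists>y\<in>A. dist y z < e" if "e > 0" for e
      using lim[OF that, of x] FA x by blast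
    then show "z \<in> A"
      using \<open>closed A\<close> by (simp flip: closed_approachable)
  qed
  have F_nonexp: "dist (F i x) (F i y) \<le> dist x y" for i x y
    unfolding dist_real_def assms(2)
    using assms(1)[of i] mult_right_mono[of "r i" 1 "\<bar>x - y\<bar>"] by simp
  have inv: "invariant_set F (closure (enlargement A \<alpha>))" if "\<alpha> > 0" for \<alpha>
  proof (rule invariant_set_if_limit_involution[where G = G])
    show "closure (enlargement A \<alpha>) \<noteq> {}"
      using enlargement_superset[OF that, of A] \<open>A \<noteq> {}\<close> by auto
    show "F i ` closure (enlargement A \<alpha>) \<subseteq> closure (enlargement A \<alpha>)" for i
      by (rule nonexpansive_image_closure_enlargement[OF F_nonexp FA \<open>A \<noteq> {}\<close>])
    show "G ` closure (enlargement A \<alpha>) \<subseteq> closure (enlargement A \<alpha>)"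
      by (rule nonexpansive_image_closure_enlargement[OF _ GA \<open>A \<noteq> {}\<close>]) (simp add: G(2))
  qed (use G(1) lim in auto)
  have "bounded (closure (enlargement A 1))" "closure (enlargement A 1) \<noteq> A"
    using \<open>bounded A\<close> \<open>A \<noteq> {}\<close> \<open>closed A\<close>
    by (auto intro!: bounded_closure bounded_enlargement dest: closure_enlargement_neq[of _ 1])
  then show ?thesis
    using inv[of 1] zero_less_one by blast
qed

end
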